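(* Let $n\ge 5$ and $k\ge 1$, and let $UUV_n(k)$ be the universal unrestricted virtual braid group. (1) The commutator subgroup $UUV_n(k)'$ is perfect. (2) The symmetric group $S_n$ is the smallest non-abelian finite quotient of $UUV_n(k)$.
   Context: The universal virtual braid group $UV_n(k)$ is the group with generators $\rho_i,\sigma_{i,t}$ ($1\le i\le n-1$, $1\le t\le k$) and defining relations: (1) $\rho_i^2=1$; $\rho_i\rho_{i+1}\rho_i=\rho_{i+1}\rho_i\rho_{i+1}$ for $1\le i\le n-2$; $\rho_i\rho_j=\rho_j\rho_i$ for $|i-j|\ge 2$; (2) $\sigma_{i,t}\sigma_{j,\ell}=\sigma_{j,\ell}\sigma_{i,t}$ for $|i-j|\ge 2$ and all $1\le t,\ell\le k$; (3) $\sigma_{i,t}\rho_j=\rho_j\sigma_{i,t}$ for $|i-j|\ge 2$; (4) $\rho_i\rho_{i+1}\sigma_{i,t}=\sigma_{i+1,t}\rho_i\rho_{i+1}$ for $1\le i\le n-2$, $1\le t\le k$. The universal unrestricted virtual braid group is $UUV_n(k)=UV_n(k)/\langle\!\langle F1,F2\rangle\!\rangle$, where $(F1)$ is the family $\rho_i\sigma_{i+1,t}\sigma_{i,t}=\sigma_{i+1,t}\sigma_{i,t}\rho_{i+1}$ and $(F2)$ is the family $\rho_{i+1}\sigma_{i,t}\sigma_{i+1,t}=\sigma_{i,t}\sigma_{i+1,t}\rho_i$, for all $1\le i\le n-2$, $1\le t\le k$, and $\langle\!\langle\cdot\rangle\!\rangle$ denotes normal closure. "Smallest" means of least order among the non-abelian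 finite quotients. A group $G$ is perfect if $G=[G,G]$. *)

theory Defs
  imports "HOL-Algebra.Sym_Groups"
begin

section \<open>Free groups and imposing relations\<close>

text \<open>A letter \<open>(x, True)\<close> stands for the generator \<open>x\<close> and \<open>(x, False)\<close> for its formal
  inverse. The free group on \<open>X\<close> consists of the words over \<open>X\<close> modulo insertion and deletion of
  adjacent mutually inverse letters.\<close>

type_synonym 'a word = "('a \<times> bool) list"

definition words :: "'a set \<Rightarrow> 'a word set" where
  "words X = lists (X \<times> UNIV)"

inductive free_cong :: "'a set \<Rightarrow> 'a word \<Rightarrow> 'a word \<Rightarrow> bool" for X where
  refl: "u \<in> words X \<Longrightarrow> free_cong X u u"
| sym: "free_cong X u v \<Longrightarrow> free_cong X v u"
| trans: "free_cong X u v \<Longrightarrow> free_cong X v w \<Longrightarrow> free_cong X u w"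
| cancel: "u \<in> words X \<Longrightarrow> v \<in> words X \<Longrightarrow> x \<in> X \<Longrightarrow>
    free_cong X (u @ [(x, b), (x, \<not> b)] @ v) (u @ v)"

definition free_rel :: "'a set \<Rightarrow> 'a word rel" where
  "free_rel X = {(u, v). free_cong X u v}"

definition free_group :: "'a set \<Rightarrow> 'a word set monoid" where
  "free_group X = \<lparr>carrier = words X // free_rel X,
     mult = (\<lambda>A B. \<Union>u\<in>A. \<Union>v\<in>B. free_rel X `` {u @ v}),
     one = free_rel X `` {[]}\<rparr>"

definition free_gen :: "'a set \<Rightarrow> 'a \<Rightarrow> 'a word set" where
  "free_gen X x = free_rel X `` {[(x, True)]}"

definition normal_closure :: "('a, 'b) monoid_scheme \<Rightarrow> 'a set \<Rightarrow> 'a set" where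
  "normal_closure G S = \<Inter> {N. N \<lhd> G \<and> S \<subseteq> N}"

text \<open>A pair \<open>(a, b)\<close> encodes the relation \<open>a = b\<close>, i.e. the relator \<open>a b\<^sup>-\<^sup>1\<close>.\<close>

definition relation_closure :: "('a, 'b) monoid_scheme \<Rightarrow> ('a \<times> 'a) set \<Rightarrow> 'a set" where
  "relation_closure G R = normal_closure G {a \<otimes>\<^bsub>G\<^esub> inv\<^bsub>G\<^esub> b | a b. (a, b) \<in> R}"

definition impose :: "('a, 'b) monoid_scheme \<Rightarrow> ('a \<times> 'a) set \<Rightarrow> 'a set monoid" where
  "impose G R = G Mod relation_closure G R"


section \<open>Universal virtual braid groups\<close>

datatype uv_gen = Rho nat | Sig nat nat

definition uv_gens :: "nat \<Rightarrow> nat \<Rightarrow> uv_gen set" where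
  "uv_gens n k = {Rho i | i. 1 \<le> i \<and> i \<le> n - 1}
     \<union> {Sig i t | i t. 1 \<le> i \<and> i \<le> n - 1 \<and> 1 \<le> t \<and> t \<le> k}"

text \<open>The families of relations, for arbitrary elements \<open>r i\<close> and \<open>s i t\<close> of a group \<open>G\<close> in the
  role of \<open>\<rho>\<^sub>i\<close> and \<open>\<sigma>\<^sub>i\<^sub>,\<^sub>t\<close>.\<close>

context fixes G :: "('a, 'b) monoid_scheme" (structure)
begin

definition uv_relations ::
  "nat \<Rightarrow> nat \<Rightarrow> (nat \<Rightarrow> 'a) \<Rightarrow> (nat \<Rightarrow> nat \<Rightarrow> 'a) \<Rightarrow> ('a \<times> 'a) set" where
  "uv_relations n k r s =
     {(r i \<otimes> r i, \<one>) | i. i \<in> {1..n-1}}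
   \<union> {(r i \<otimes> r (i+1) \<otimes> r i, r (i+1) \<otimes> r i \<otimes> r (i+1)) | i. i \<in> {1..n-2}}
   \<union> {(r i \<otimes> r j, r j \<otimes> r i) | i j.
        i \<in> {1..n-1} \<and> j \<in> {1..n-1} \<and> \<bar>int i - int j\<bar> \<ge> 2}
   \<union> {(s i t \<otimes> s j l, s j l \<otimes> s i t) | i j t l.
        i \<in> {1..n-1} \<and> j \<in> {1..n-1} \<and> \<bar>int i - int j\<bar> \<ge> 2 \<and> t \<in> {1..k} \<and> l \<in> {1..k}}
   \<union> {(s i t \<otimes> r j, r j \<otimes> s i t) | i j t.
        i \<in> {1..n-1} \<and> j \<in> {1..n-1} \<and> \<bar>int i - int j\<bar> \<ge> 2 \<and> t \<in> {1..k}}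
   \<union> {(r i \<otimes> r (i+1) \<otimes> s i t, s (i+1) t \<otimes> r i \<otimes> r (i+1)) | i t.
        i \<in> {1..n-2} \<and> t \<in> {1..k}}"

definition forbidden_relations ::
  "nat \<Rightarrow> nat \<Rightarrow> (nat \<Rightarrow> 'a) \<Rightarrow> (nat \<Rightarrow> nat \<Rightarrow> 'a) \<Rightarrow> ('a \<times> 'a) set" where
  "forbidden_relations n k r s =
     {(r i \<otimes> s (i+1) t \<otimes> s i t, s (i+1) t \<otimes> s i t \<otimes> r (i+1)) | i t.
        i \<in> {1..n-2} \<and> t \<in> {1..k}}
   \<union> {(r (i+1) \<otimes> s i t \<otimes> s (i+1) t, s i t \<otimes> s (i+1) t \<otimes> r i) | i t.
        i \<in> {1..n-2} \<and> t \<in> {1..k}}"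

end

definition UV_free_relations ::
  "nat \<Rightarrow> nat \<Rightarrow> (uv_gen word set \<times> uv_gen word set) set" where
  "UV_free_relations n k = uv_relations (free_group (uv_gens n k)) n k
     (\<lambda>i. free_gen (uv_gens n k) (Rho i)) (\<lambda>i t. free_gen (uv_gens n k) (Sig i t))"

definition UV :: "nat \<Rightarrow> nat \<Rightarrow> uv_gen word set set monoid" where
  "UV n k = impose (free_group (uv_gens n k)) (UV_free_relations n k)"

definition UV_gen :: "nat \<Rightarrow> nat \<Rightarrow> uv_gen \<Rightarrow> uv_gen word set set" where
  "UV_gen n k x = relation_closure (free_group (uv_gens n k)) (UV_free_relations n k)
     #>\<^bsub>free_group (uv_gens n k)\<^esub> free_gen (uv_gens n k) x"

definition UUV :: "nat \<Rightarrow> nat \<Rightarrow> uv_gen word set set set monoid" where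
  "UUV n k = impose (UV n k) (forbidden_relations (UV n k) n k
     (\<lambda>i. UV_gen n k (Rho i)) (\<lambda>i t. UV_gen n k (Sig i t)))"


section \<open>Perfect groups and smallest non-abelian finite quotients\<close>

definition perfect :: "('a, 'b) monoid_scheme \<Rightarrow> bool" where
  "perfect G \<longleftrightarrow> group G \<and> derived G (carrier G) = carrier G"

definition commutator_subgroup :: "('a, 'b) monoid_scheme \<Rightarrow> ('a, 'b) monoid_scheme" where
  "commutator_subgroup G = G\<lparr>carrier := derived G (carrier G)\<rparr>"

text \<open>``The smallest'' means of least order; uniqueness up to isomorphism is not part of the
  notion. Quotients of \<open>G\<close> are considered up to isomorphism.\<close>

definition smallest_nonabelian_finite_quotient ::
  "('a, 'b) monoid_scheme \<Rightarrow> ('c, 'd) monoid_scheme \<Rightarrow> bool" where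
  "smallest_nonabelian_finite_quotient Q G \<longleftrightarrow>
     (\<exists>N. N \<lhd> G \<and> G Mod N \<cong> Q)
     \<and> finite (carrier Q) \<and> group Q \<and> \<not> comm_group Q
     \<and> (\<forall>N. N \<lhd> G \<and> finite (carrier (G Mod N)) \<and> \<not> comm_group (G Mod N)
          \<longrightarrow> order Q \<le> order (G Mod N))"


section \<open>The constructions yield groups\<close>

lemma words_append_iff: "u @ v \<in> words X \<longleftrightarrow> u \<in> words X \<and> v \<in> words X"
  by (auto simp: words_def)

lemma free_cong_words: "free_cong X u v \<Longrightarrow> u \<in> words X \<and> v \<in> words X"
  by (induction rule: free_cong.induct) (auto simp: words_def)

lemma equiv_free_rel: "equiv (words X) (free_rel X)"
  by (rule equivI)
    (auto simp: free_rel_def refl_on_def sym_def trans_def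
      dest: free_cong_words intro: free_cong.intros)

lemma free_cong_append_right:
  "free_cong X u v \<Longrightarrow> w \<in> words X \<Longrightarrow> free_cong X (u @ w) (v @ w)"
proof (induction rule: free_cong.induct)
  case (cancel u v x b)
  then show ?case
    using free_cong.cancel[of u X "v @ w" x b] by (simp add: words_append_iff)
qed (auto simp: words_append_iff intro: free_cong.intros)

lemma free_cong_append_left:
  "free_cong X u v \<Longrightarrow> w \<in> words X \<Longrightarrow> free_cong X (w @ u) (w @ v)"
proof (induction rule: free_cong.induct)
  case (cancel u v x b)
  then show ?case
    using free_cong.cancel[of "w @ u" X v x b] by (simp add: words_append_iff)
qed (auto simp: words_append_iff intro: free_cong.intros)

lemma free_group_mult:
  assumes "u \<in> words X" "v \<in> words X"
  shows "free_rel X `` {u} \<otimes>\<^bsub>free_group X\<^esub> free_rel X `` {v} = free_rel X `` {u @ v}"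
proof -
  have "congruent2 (free_rel X) (free_rel X) (\<lambda>u v. free_rel X `` {u @ v})"
  proof (rule congruent2I[OF equiv_free_rel equiv_free_rel])
    fix w a b assume "w \<in> words X" "(a, b) \<in> free_rel X"
    then show "free_rel X `` {a @ w} = free_rel X `` {b @ w}"
      by (intro equiv_class_eq[OF equiv_free_rel]) (auto simp: free_rel_def free_cong_append_right)
  next
    fix w a b assume "w \<in> words X" "(a, b) \<in> free_rel X"
    then show "free_rel X `` {w @ a} = free_rel X `` {w @ b}"
      by (intro equiv_class_eq[OF equiv_free_rel]) (auto simp: free_rel_def free_cong_append_left)
  qed
  then show ?thesis
    using UN_equiv_class2[OF equiv_free_rel equiv_free_rel _ assms] by (simp add: free_group_def)
qed

lemma free_group_carrier:
  "A \<in> carrier (free_group X) \<longleftrightarrow> (\<exists>u \<in> words X. A = free_rel X `` {u})"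
  by (auto simp: free_group_def quotient_def)

definition inv_word :: "'a word \<Rightarrow> 'a word" where
  "inv_word u = rev (map (\<lambda>(x, b). (x, \<not> b)) u)"

lemma inv_word_words: "u \<in> words X \<Longrightarrow> inv_word u \<in> words X"
  by (auto simp: words_def inv_word_def)

lemma free_cong_inv_word: "u \<in> words X \<Longrightarrow> free_cong X (inv_word u @ u) []"
proof (induction u)
  case Nil
  then show ?case by (simp add: inv_word_def free_cong.refl)
next
  case (Cons a u)
  obtain x b where a: "a = (x, b)" by force
  have x: "x \<in> X" and u: "u \<in> words X" using Cons.prems a by (auto simp: words_def)
  have "free_cong X (inv_word u @ [(x, \<not> b), (x, \<not> \<not> b)] @ u) (inv_word u @ u)"
    by (rule free_cong.cancel[OF inv_word_words[OF u] u x])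
  then show ?case
    using Cons.IH[OF u] by (auto simp: a inv_word_def intro: free_cong.trans)
qed

lemma group_free_group: "group (free_group X)"
proof (rule groupI)
  have nil: "[] \<in> words X" by (simp add: words_def)
  have one: "\<one>\<^bsub>free_group X\<^esub> = free_rel X `` {[]}" by (simp add: free_group_def)
  show "\<one>\<^bsub>free_group X\<^esub> \<in> carrier (free_group X)"
    unfolding free_group_carrier one using nil by blast
  fix A assume "A \<in> carrier (free_group X)"
  then obtain u where u: "u \<in> words X" and A: "A = free_rel X `` {u}"
    by (auto simp: free_group_carrier)
  show "\<one>\<^bsub>free_group X\<^esub> \<otimes>\<^bsub>free_group X\<^esub> A = A"
    unfolding one A free_group_mult[OF nil u] by simp
  have "free_rel X `` {inv_word u @ u} = free_rel X `` {[]}"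
    by (rule equiv_class_eq[OF equiv_free_rel]) (simp add: free_rel_def free_cong_inv_word u)
  then have "free_rel X `` {inv_word u} \<otimes>\<^bsub>free_group X\<^esub> A = \<one>\<^bsub>free_group X\<^esub>"
    unfolding one A free_group_mult[OF inv_word_words[OF u] u] .
  then show "\<exists>B \<in> carrier (free_group X). B \<otimes>\<^bsub>free_group X\<^esub> A = \<one>\<^bsub>free_group X\<^esub>"
    using inv_word_words[OF u] free_group_carrier by blast
  fix B assume "B \<in> carrier (free_group X)"
  then obtain v where v: "v \<in> words X" and B: "B = free_rel X `` {v}"
    by (auto simp: free_group_carrier)
  show "A \<otimes>\<^bsub>free_group X\<^esub> B \<in> carrier (free_group X)"
    unfolding A B free_group_mult[OF u v] free_group_carrier using u v words_append_iff by blast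
  fix C assume "C \<in> carrier (free_group X)"
  then obtain w where w: "w \<in> words X" and C: "C = free_rel X `` {w}"
    by (auto simp: free_group_carrier)
  have uv: "u @ v \<in> words X" and vw: "v @ w \<in> words X" using u v w by (auto simp: words_append_iff)
  show "A \<otimes>\<^bsub>free_group X\<^esub> B \<otimes>\<^bsub>free_group X\<^esub> C = A \<otimes>\<^bsub>free_group X\<^esub> (B \<otimes>\<^bsub>free_group X\<^esub> C)"
    unfolding A B C free_group_mult[OF u v] free_group_mult[OF uv w] free_group_mult[OF v w]
      free_group_mult[OF u vw] by simp
qed

lemma free_gen_in_carrier: "x \<in> X \<Longrightarrow> free_gen X x \<in> carrier (free_group X)"
  unfolding free_group_carrier free_gen_def by (auto simp: words_def intro!: bexI)

lemma (in group) carrier_normal: "carrier G \<lhd> G"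
  by (simp add: normal_inv_iff subgroup_self)

lemma (in group) normal_closure_normal:
  assumes "S \<subseteq> carrier G"
  shows "normal_closure G S \<lhd> G"
proof -
  have "subgroup (\<Inter> {N. N \<lhd> G \<and> S \<subseteq> N}) G"
    using assms carrier_normal by (intro subgroups_Inter) (auto intro: normal_imp_subgroup)
  then show ?thesis
    unfolding normal_inv_iff normal_closure_def by (auto simp: normal_inv_iff)
qed

lemma (in group) relation_closure_normal:
  assumes "R \<subseteq> carrier G \<times> carrier G"
  shows "relation_closure G R \<lhd> G"
  unfolding relation_closure_def using assms by (intro normal_closure_normal) auto

lemma (in group) group_impose:
  assumes "R \<subseteq> carrier G \<times> carrier G"
  shows "group (impose G R)"
  unfolding impose_def by (intro normal.factorgroup_is_group relation_closure_normal assms)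

lemma (in group) uv_relations_carrier:
  assumes "\<And>i. i \<in> {1..n-1} \<Longrightarrow> r i \<in> carrier G"
    and "\<And>i t. i \<in> {1..n-1} \<Longrightarrow> t \<in> {1..k} \<Longrightarrow> s i t \<in> carrier G"
  shows "uv_relations G n k r s \<subseteq> carrier G \<times> carrier G"
    and "forbidden_relations G n k r s \<subseteq> carrier G \<times> carrier G"
  unfolding uv_relations_def forbidden_relations_def
  by (auto intro!: m_closed assms)

lemma UV_free_relations_carrier:
  "UV_free_relations n k
     \<subseteq> carrier (free_group (uv_gens n k)) \<times> carrier (free_group (uv_gens n k))"
  unfolding UV_free_relations_def
  by (intro group.uv_relations_carrier group_free_group free_gen_in_carrier)
    (auto simp: uv_gens_def)

lemma group_UV: "group (UV n k)"
  unfolding UV_def by (intro group.group_impose group_free_group UV_free_relations_carrier)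

lemma UV_gen_in_carrier:
  assumes "x \<in> uv_gens n k"
  shows "UV_gen n k x \<in> carrier (UV n k)"
  unfolding UV_gen_def UV_def impose_def FactGroup_def RCOSETS_def
  using free_gen_in_carrier[OF assms] by auto

lemma group_UUV: "group (UUV n k)"
  unfolding UUV_def
  by (intro group.group_impose group_UV group.uv_relations_carrier UV_gen_in_carrier)
    (auto simp: uv_gens_def)

end

theory Submission
  imports Defs
begin

text \<open>
  Everything rests on a dichotomy for a group \<open>G\<close> generated by elements \<open>\<rho>\<^sub>i\<close> and \<open>\<sigma>\<^sub>i\<^sub>,\<^sub>t\<close> that satisfy
  the relations of \<open>UV\<^sub>n(k)\<close>, where \<open>n \<ge> 5\<close>; every quotient of \<open>UUV\<^sub>n(k)\<close> is such a group.

  If \<open>\<rho>\<^sub>1 = \<rho>\<^sub>2\<close>, then \<open>G\<close> is abelian (\<open>comm_group_of_first_two_eq\<close>). Indeed the equality spreads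
  along the Coxeter diagram: if \<open>\<rho>\<^sub>j = \<rho>\<^sub>j\<^sub>+\<^sub>1\<close>, then \<open>\<rho>\<^sub>j\<^sub>+\<^sub>1\<close> commutes with \<open>\<rho>\<^sub>j\<^sub>+\<^sub>2\<close> because \<open>\<rho>\<^sub>j\<close> does,
  and two commuting involutions that satisfy the braid relation are equal. As all \<open>\<rho>\<^sub>i\<close> are now one
  involution, the mixed relation \<open>\<rho>\<^sub>i \<rho>\<^sub>i\<^sub>+\<^sub>1 \<sigma>\<^sub>i\<^sub>,\<^sub>t = \<sigma>\<^sub>i\<^sub>+\<^sub>1\<^sub>,\<^sub>t \<rho>\<^sub>i \<rho>\<^sub>i\<^sub>+\<^sub>1\<close> makes \<open>\<sigma>\<^sub>i\<^sub>,\<^sub>t\<close> independent of \<open>i\<close>,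
  and the commutation relations between distant indices become commutation of all generators.

  If \<open>\<rho>\<^sub>1 \<noteq> \<rho>\<^sub>2\<close>, then \<open>G\<close> has at least \<open>n!\<close> elements (\<open>fact_le_order\<close>). The \<open>\<rho>\<^sub>i\<close> produce an element
  \<open>tr a b\<close> for every transposition, and conjugation by \<open>\<rho>\<^sub>i\<close> permutes these elements in the way in
  which the adjacent transposition acts on pairs of points (\<open>cj_tr\<close>). If two different pairs had the
  same element, then conjugation would identify all of them, in particular \<open>\<rho>\<^sub>1\<close> and \<open>\<rho>\<^sub>2\<close>. Hence an
  element of \<open>G\<close> that acts on the pairs like a permutation \<open>p\<close> determines \<open>p\<close>, and all \<open>n!\<close>
  permutations occur.

  The lower bound for non-abelian finite quotients follows at once. For perfectness of \<open>G'\<close> the first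
  half is applied to \<open>G/G''\<close>: the products \<open>\<rho>\<^sub>1 \<rho>\<^sub>2\<close> and \<open>\<rho>\<^sub>1 \<rho>\<^sub>4\<close> lie in the derived subgroup, which
  is abelian in \<open>G/G''\<close>, and if these two products commute, then \<open>\<rho>\<^sub>1 = \<rho>\<^sub>2\<close>. So \<open>G/G''\<close> is abelian,
  that is, \<open>G' = G''\<close>.

  Finally, sending both \<open>\<rho>\<^sub>i\<close> and \<open>\<sigma>\<^sub>i\<^sub>,\<^sub>t\<close> to the transposition of \<open>i\<close> and \<open>i+1\<close> turns each defining
  relation of \<open>UUV\<^sub>n(k)\<close> into a commutation, braid or involution relation of transpositions, so the
  symmetric group is a quotient (\<open>UUV_onto_sym_group\<close>).
\<close>

section \<open>Adjacent transpositions\<close>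

lemma permutes_adjacent_induct:
  assumes "p permutes {1..n}" and "P id"
    and step: "\<And>i p. 1 \<le> i \<Longrightarrow> i < n \<Longrightarrow> P p \<Longrightarrow> P (transpose i (Suc i) \<circ> p)"
  shows "P p"
  using assms(1) finite_atLeastAtMost
proof (induction rule: permutes_induct)
  case id
  show ?case by (fact \<open>P id\<close>)
next
  case (swap a b p)
  have seq: "P (apply_adj_transps xs \<circ> p)" if "set xs \<subseteq> {1..<n}" for xs
    using that by (induction xs) (auto simp: swap.IH comp_assoc intro: step)
  have less: "P (transpose a b \<circ> p)" if "a < b" "1 \<le> a" "b \<le> n" for a b
    using seq[of "adj_transp_seq a b"] that by (auto simp: set_adj_transp_seq adj_transp_seq_correct)
  show ?case
    using less[of a b] less[of b a] swap.hyps transpose_commute[of a b]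
    by (metis atLeastAtMost_iff nat_neq_iff)
qed

text \<open>The point \<open>a\<close> is the only common point of two different pairs through \<open>a\<close>, so its image is the
  only common point of the images of these pairs.\<close>

lemma permutation_eq_of_doubletons:
  assumes "n \<ge> 3" and p: "p permutes {1..n::nat}" and q: "q permutes {1..n}"
    and eq: "\<And>a b. a \<in> {1..n} \<Longrightarrow> b \<in> {1..n} \<Longrightarrow> a \<noteq> b \<Longrightarrow> {p a, p b} = {q a, q b}"
  shows "p = q"
proof
  fix a
  show "p a = q a"
  proof (cases "a \<in> {1..n}")
    case True
    have "card ({1..n} - {a}) \<ge> 2" using assms(1) True by simp
    then obtain b c where bc: "b \<in> {1..n}" "c \<in> {1..n}" "a \<noteq> b" "a \<noteq> c" "b \<noteq> c"
      by (metis DiffE card_le_Suc0_iff_eq finite_Diff finite_atLeastAtMost insertI1 not_less_eq_eq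
          numeral_2_eq_2)
    have "p a \<noteq> p b" "p a \<noteq> p c" "p b \<noteq> p c" "q b \<noteq> q c"
      using permutes_inj[OF p] permutes_inj[OF q] bc by (auto simp: inj_eq)
    then show ?thesis
      using eq[OF True bc(1,3)] eq[OF True bc(2,4)] by (auto simp: doubleton_eq_iff)
  next
    case False
    then show ?thesis using p q by (simp add: permutes_def)
  qed
qed


section \<open>Groups generated by Coxeter generators of the symmetric group\<close>

locale coxeter_type_A = group G for G (structure) +
  fixes n :: nat and r :: "nat \<Rightarrow> 'a"
  assumes r_closed [simp]: "1 \<le> i \<Longrightarrow> i < n \<Longrightarrow> r i \<in> carrier G"
    and r_square: "1 \<le> i \<Longrightarrow> i < n \<Longrightarrow> r i \<otimes> r i = \<one>"
    and r_braid: "1 \<le> i \<Longrightarrow> Suc i < n \<Longrightarrow>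
      r i \<otimes> r (Suc i) \<otimes> r i = r (Suc i) \<otimes> r i \<otimes> r (Suc i)"
    and r_far: "1 \<le> i \<Longrightarrow> Suc i < j \<Longrightarrow> j < n \<Longrightarrow> r i \<otimes> r j = r j \<otimes> r i"
begin

text \<open>Conjugation by \<open>r i\<close>, as \<open>r i\<close> is an involution. The action on transpositions is computed with
  these operators, which satisfy the same far commutation and braid relations as the \<open>r i\<close>.\<close>

definition cj :: "nat \<Rightarrow> 'a \<Rightarrow> 'a" where
  "cj i x = r i \<otimes> x \<otimes> r i"

text \<open>The element \<open>up a d\<close> belongs to the transposition of \<open>a\<close> and \<open>a + d + 1\<close>; the recursion moves
  the upper point by one adjacent transposition at a time.\<close>

primrec up :: "nat \<Rightarrow> nat \<Rightarrow> 'a" where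
  "up a 0 = r a"
| "up a (Suc d) = cj (Suc (a + d)) (up a d)"

definition tr :: "nat \<Rightarrow> nat \<Rightarrow> 'a" where
  "tr a b = (if a < b then up a (b - a - 1) else up b (a - b - 1))"

lemma cj_closed [simp]:
  "1 \<le> i \<Longrightarrow> i < n \<Longrightarrow> x \<in> carrier G \<Longrightarrow> cj i x \<in> carrier G"
  by (simp add: cj_def)

lemma up_closed [simp]: "1 \<le> a \<Longrightarrow> a + d < n \<Longrightarrow> up a d \<in> carrier G"
  by (induction d) simp_all

lemma r_cancel: "1 \<le> i \<Longrightarrow> i < n \<Longrightarrow> x \<in> carrier G \<Longrightarrow> r i \<otimes> (r i \<otimes> x) = x"
  by (simp add: m_assoc[symmetric] r_square)

lemma inv_r: "1 \<le> i \<Longrightarrow> i < n \<Longrightarrow> inv (r i) = r i"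
  by (simp add: inv_equality r_square)

lemma cj_cj: "1 \<le> i \<Longrightarrow> i < n \<Longrightarrow> x \<in> carrier G \<Longrightarrow> cj i (cj i x) = x"
  by (simp add: cj_def m_assoc r_cancel r_square)

lemma cj_r_self: "1 \<le> i \<Longrightarrow> i < n \<Longrightarrow> cj i (r i) = r i"
  by (simp add: cj_def m_assoc r_square)

lemma cj_r_far:
  assumes "1 \<le> i" "i < n" "1 \<le> j" "j < n" "Suc i < j \<or> Suc j < i"
  shows "cj i (r j) = r j"
proof -
  have "r i \<otimes> r j = r j \<otimes> r i" using assms r_far by metis
  then show ?thesis using assms by (simp add: cj_def m_assoc r_square)
qed

lemma cj_r_adjacent: "1 \<le> i \<Longrightarrow> Suc i < n \<Longrightarrow> cj i (r (Suc i)) = cj (Suc i) (r i)"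
  by (simp add: cj_def r_braid)

lemma cj_commute:
  assumes "1 \<le> i" "i < n" "1 \<le> j" "j < n" "Suc i < j \<or> Suc j < i" "x \<in> carrier G"
  shows "cj i (cj j x) = cj j (cj i x)"
proof -
  have c: "r i \<otimes> r j = r j \<otimes> r i" using assms r_far by metis
  have "cj i (cj j x) = (r i \<otimes> r j) \<otimes> x \<otimes> (r j \<otimes> r i)"
    using assms by (simp add: cj_def m_assoc)
  also have "\<dots> = (r j \<otimes> r i) \<otimes> x \<otimes> (r i \<otimes> r j)" by (simp add: c)
  also have "\<dots> = cj j (cj i x)" using assms by (simp add: cj_def m_assoc)
  finally show ?thesis .
qed

lemma cj_braid:
  assumes "1 \<le> i" "Suc i < n" "x \<in> carrier G"
  shows "cj i (cj (Suc i) (cj i x)) = cj (Suc i) (cj i (cj (Suc i) x))"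
proof -
  let ?j = "Suc i"
  have "cj i (cj ?j (cj i x)) = (r i \<otimes> r ?j \<otimes> r i) \<otimes> x \<otimes> (r i \<otimes> r ?j \<otimes> r i)"
    using assms by (simp add: cj_def m_assoc)
  also have "\<dots> = (r ?j \<otimes> r i \<otimes> r ?j) \<otimes> x \<otimes> (r ?j \<otimes> r i \<otimes> r ?j)"
    using assms by (simp add: r_braid)
  also have "\<dots> = cj ?j (cj i (cj ?j x))" using assms by (simp add: cj_def m_assoc)
  finally show ?thesis .
qed

lemma cj_up_outside:
  assumes "1 \<le> i" "i < n" "1 \<le> a" "a + d < n" "Suc i < a \<or> Suc (a + d) < i"
  shows "cj i (up a d) = up a d"
  using assms(4,5)
proof (induction d)
  case 0
  then show ?case using assms cj_r_far by auto
next
  case (Suc d)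
  then have "cj i (cj (Suc (a + d)) (up a d)) = cj (Suc (a + d)) (cj i (up a d))"
    using assms by (intro cj_commute) auto
  then show ?case using Suc by auto
qed

lemma cj_up_left:
  assumes "1 \<le> a" "Suc a + d < n"
  shows "cj a (up (Suc a) d) = up a (Suc d)"
  using assms(2)
proof (induction d)
  case 0
  then show ?case using assms cj_r_adjacent by simp
next
  case (Suc d)
  let ?j = "Suc (Suc (a + d))"
  have "cj a (cj ?j (up (Suc a) d)) = cj ?j (cj a (up (Suc a) d))"
    using assms Suc by (intro cj_commute) auto
  then show ?case using Suc by simp
qed

text \<open>An adjacent transposition strictly between the two points acts trivially. The operator commutes
  past the outer steps of the recursion until \<open>i\<close> is next to the upper point; there the braid relation
  turns it into \<open>cj (Suc i)\<close> on the inside, where it lies outside of the remaining interval.\<close>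

lemma cj_up_inside:
  assumes "1 \<le> a" "a + d < n" "a < i" "i < a + d"
  shows "cj i (up a d) = up a d"
  using assms(2,4)
proof (induction d)
  case 0
  then show ?case using assms by simp
next
  case (Suc d)
  show ?case
  proof (cases "i = a + d")
    case False
    then have "cj i (cj (Suc (a + d)) (up a d)) = cj (Suc (a + d)) (cj i (up a d))"
      using assms Suc.prems by (intro cj_commute) auto
    then show ?thesis using Suc False by simp
  next
    case True
    then obtain e where e: "d = Suc e" using assms(3) by (cases d) auto
    have i: "i = Suc (a + e)" using True e by simp
    have "cj i (cj (Suc i) (cj i (up a e))) = cj (Suc i) (cj i (cj (Suc i) (up a e)))"
      using assms Suc.prems e i by (intro cj_braid) auto
    also have "cj (Suc i) (up a e) = up a e"
      using assms Suc.prems e i by (intro cj_up_outside) auto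
    finally show ?thesis using e i by simp
  qed
qed

lemma tr_sym: "a \<noteq> b \<Longrightarrow> tr a b = tr b a"
  by (auto simp: tr_def)

lemma tr_closed [simp]:
  assumes "a \<in> {1..n}" "b \<in> {1..n}" "a \<noteq> b"
  shows "tr a b \<in> carrier G"
  using assms unfolding tr_def by auto

lemma tr_adjacent: "tr a (Suc a) = r a"
  by (simp add: tr_def)

lemma cj_tr_less:
  assumes i: "1 \<le> i" "i < n" and ab: "1 \<le> a" "a < b" "b \<le> n"
  shows "cj i (tr a b) = tr (transpose i (Suc i) a) (transpose i (Suc i) b)"
proof -
  let ?s = "transpose i (Suc i)"
  have up: "tr c (Suc (c + e)) = up c e" for c e by (simp add: tr_def)
  obtain d where b: "b = Suc (a + d)" using less_imp_Suc_add[OF \<open>a < b\<close>] by auto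
  have an: "a + d < n" using ab b by simp
  have fixed: "?s a = a" "?s b = b" if "i \<noteq> a" "i \<noteq> b" "Suc i \<noteq> a" "Suc i \<noteq> b"
    using that by auto
  consider "Suc i < a \<or> b < i" | "Suc i = a" | "i = a" "d = 0" | "i = a" "d > 0"
    | "a < i" "i < a + d" | "i = a + d" "d > 0" | "i = b"
    using b by linarith
  then show ?thesis
  proof cases
    case 1
    then have "cj i (up a d) = up a d" using i ab an b by (intro cj_up_outside) auto
    then show ?thesis using fixed 1 b up ab by auto
  next
    case 2
    then have s: "?s a = i" "?s b = b" using b by auto
    have "cj i (up (Suc i) d) = up i (Suc d)" using 2 i an by (intro cj_up_left) auto
    moreover have "tr i b = up i (Suc d)" using up[of i "Suc d"] b 2[symmetric] by simp
    moreover have "tr a b = up (Suc i) d" using up b 2 by simp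
    ultimately show ?thesis by (simp only: s)
  next
    case 3
    then have s: "?s a = b" "?s b = a" using b by auto
    have "tr a b = r i" using 3 b tr_adjacent by simp
    moreover have "tr b a = tr a b" using ab by (intro tr_sym) simp
    ultimately show ?thesis using cj_r_self[OF i] by (simp only: s)
  next
    case 4
    obtain e where e: "d = Suc e" using 4 by (cases d) auto
    from 4 have s: "?s a = Suc a" "?s b = b" using b by auto
    have "cj a (up (Suc a) e) = up a d" using 4 e ab an cj_up_left[of a e] by simp
    then have "cj a (up a d) = up (Suc a) e" using cj_cj[of a "up (Suc a) e"] 4 e ab an by simp
    moreover have "tr (Suc a) b = up (Suc a) e" using up[of "Suc a" e] 4 e b by simp
    moreover have "tr a b = up a d" using up b by simp
    ultimately show ?thesis unfolding s using 4 by simp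
  next
    case 5
    then have "cj i (up a d) = up a d" using ab an by (intro cj_up_inside) auto
    then show ?thesis using fixed 5 b up by auto
  next
    case 6
    obtain e where e: "d = Suc e" using 6 by (cases d) auto
    from 6 have s: "?s a = a" "?s b = i" using b by auto
    have "cj i (up a d) = up a e" using 6 e ab an cj_cj[of i "up a e"] by simp
    moreover have "tr a i = up a e" using up[of a e] 6 e by simp
    moreover have "tr a b = up a d" using up b by simp
    ultimately show ?thesis by (simp only: s)
  next
    case 7
    then have s: "?s a = a" "?s b = Suc b" using b by auto
    have "tr a (Suc b) = up a (Suc d)" using up[of a "Suc d"] b by simp
    moreover have "tr a b = up a d" using up b by simp
    ultimately show ?thesis using 7 b by (simp only: s) simp
  qed
qed

lemma cj_tr:
  assumes i: "1 \<le> i" "i < n" and ab: "a \<in> {1..n}" "b \<in> {1..n}" "a \<noteq> b"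
  shows "cj i (tr a b) = tr (transpose i (Suc i) a) (transpose i (Suc i) b)"
proof -
  consider "a < b" | "b < a" using ab by linarith
  then show ?thesis
  proof cases
    case 1
    then show ?thesis using cj_tr_less[OF i] ab by simp
  next
    case 2
    have "transpose i (Suc i) b \<noteq> transpose i (Suc i) a" using ab transpose_eq_imp_eq by metis
    then have "tr (transpose i (Suc i) a) (transpose i (Suc i) b)
        = tr (transpose i (Suc i) b) (transpose i (Suc i) a)"
      by (intro tr_sym) simp
    moreover have "tr a b = tr b a" using ab by (intro tr_sym)
    ultimately show ?thesis using 2 cj_tr_less[OF i, of b a] ab by simp
  qed
qed

text \<open>Every permutation is a product of adjacent transpositions, and the corresponding product of the
  \<open>r i\<close> acts on the elements \<open>tr a b\<close> as the permutation acts on the pairs.\<close>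

lemma conjugation_realizes_permutation:
  assumes "p permutes {1..n}"
  shows "\<exists>x \<in> carrier G. \<forall>a \<in> {1..n}. \<forall>b \<in> {1..n}. a \<noteq> b \<longrightarrow>
    x \<otimes> tr a b \<otimes> inv x = tr (p a) (p b)"
proof -
  let ?Q = "\<lambda>p. p permutes {1..n} \<and> (\<exists>x \<in> carrier G. \<forall>a \<in> {1..n}. \<forall>b \<in> {1..n}. a \<noteq> b \<longrightarrow>
    x \<otimes> tr a b \<otimes> inv x = tr (p a) (p b))"
  have "?Q p"
    using assms
  proof (rule permutes_adjacent_induct[where P = ?Q])
    show "?Q id" by (auto intro!: bexI[of _ \<one>] permutes_id)
  next
    fix i p assume i: "1 \<le> i" "i < n" and "?Q p"
    then obtain x where p: "p permutes {1..n}" and x: "x \<in> carrier G" and xt: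
      "\<And>a b. a \<in> {1..n} \<Longrightarrow> b \<in> {1..n} \<Longrightarrow> a \<noteq> b \<Longrightarrow> x \<otimes> tr a b \<otimes> inv x = tr (p a) (p b)"
      by blast
    have "(transpose i (Suc i) \<circ> p) permutes {1..n}"
      using i by (intro permutes_compose[OF p] permutes_swap_id) auto
    moreover have "(r i \<otimes> x) \<otimes> tr a b \<otimes> inv (r i \<otimes> x)
        = tr ((transpose i (Suc i) \<circ> p) a) ((transpose i (Suc i) \<circ> p) b)"
      if ab: "a \<in> {1..n}" "b \<in> {1..n}" "a \<noteq> b" for a b
    proof -
      have pab: "p a \<in> {1..n}" "p b \<in> {1..n}" "p a \<noteq> p b"
        using ab permutes_in_image[OF p] permutes_inj[OF p] by (auto simp: inj_eq)
      have "(r i \<otimes> x) \<otimes> tr a b \<otimes> inv (r i \<otimes> x) = cj i (x \<otimes> tr a b \<otimes> inv x)"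
        using i x ab by (simp add: cj_def inv_mult_group inv_r m_assoc)
      also have "\<dots> = cj i (tr (p a) (p b))" by (simp only: xt[OF ab])
      also have "\<dots> = tr ((transpose i (Suc i) \<circ> p) a) ((transpose i (Suc i) \<circ> p) b)"
        using cj_tr[OF i pab] by simp
      finally show ?thesis .
    qed
    ultimately show "?Q (transpose i (Suc i) \<circ> p)"
      using i x by (intro conjI bexI[of _ "r i \<otimes> x"]) auto
  qed
  then show ?thesis by blast
qed

lemma tr_eq_permute:
  assumes "p permutes {1..n}" "a \<in> {1..n}" "b \<in> {1..n}" "a \<noteq> b"
    and "c \<in> {1..n}" "d \<in> {1..n}" "c \<noteq> d" "tr a b = tr c d"
  shows "tr (p a) (p b) = tr (p c) (p d)"
  using conjugation_realizes_permutation[OF assms(1)] assms(2-) by metis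

lemma tr_eq_transpose:
  assumes "u \<in> {1..n}" "v \<in> {1..n}" "a \<in> {1..n}" "b \<in> {1..n}" "a \<noteq> b"
    and "c \<in> {1..n}" "d \<in> {1..n}" "c \<noteq> d" "tr a b = tr c d"
  shows "tr (transpose u v a) (transpose u v b) = tr (transpose u v c) (transpose u v d)"
  by (rule tr_eq_permute[where p = "transpose u v", OF permutes_swap_id[OF assms(1,2)] assms(3-)])

text \<open>If two transpositions with the common point \<open>p\<close> have the same element, then conjugation by the
  transpositions of \<open>c\<close> and \<open>u\<close> shows that all \<open>tr p u\<close> agree. Moving \<open>p\<close> to \<open>2\<close> gives
  \<open>tr 2 1 = tr 2 3\<close>, which is the claim.\<close>

lemma tr_overlap_collapse:
  assumes n: "n \<ge> 3" and pqr: "p \<in> {1..n}" "q \<in> {1..n}" "c \<in> {1..n}" "p \<noteq> q" "p \<noteq> c" "q \<noteq> c"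
    and eq: "tr p q = tr p c"
  shows "r 1 = r 2"
proof -
  have star: "tr p q = tr p u" if "u \<in> {1..n}" "u \<noteq> p" for u
    using tr_eq_transpose[of c u p q p c] that pqr eq
    by (cases "u = q \<or> u = c") (auto simp: transpose_def)
  have two: "2 \<in> {1..n}" using n by simp
  have eq2: "tr 2 q' = tr 2 u'" if "q' \<in> {1..n}" "q' \<noteq> 2" "u' \<in> {1..n}" "u' \<noteq> 2" for q' u'
  proof -
    let ?f = "transpose p 2"
    have f: "?f q' \<in> {1..n}" "?f q' \<noteq> p" "?f u' \<in> {1..n}" "?f u' \<noteq> p"
      using that pqr two by (auto simp: transpose_def)
    have "tr p (?f q') = tr p (?f u')" using star f by metis
    then have "tr (?f p) (?f (?f q')) = tr (?f p) (?f (?f u'))"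
      using f pqr two tr_eq_transpose[of p 2 p "?f q'" p "?f u'"] by simp
    then show ?thesis by simp
  qed
  have "r 1 = tr 1 2" "r 2 = tr 2 3"
    using tr_adjacent[of 1] tr_adjacent[of 2] by (simp_all add: numeral_2_eq_2 numeral_3_eq_3)
  moreover have "tr 2 1 = tr 2 3" using n by (intro eq2) auto
  ultimately show ?thesis using tr_sym[of 1 2] by simp
qed

text \<open>Disjoint pairs leave a fifth point \<open>e\<close>. Conjugation by the transposition of \<open>b\<close> and \<open>e\<close> fixes
  \<open>tr c d\<close> and replaces \<open>tr a b\<close> by \<open>tr a e\<close>, so two overlapping pairs are identified. For \<open>n = 4\<close> this
  fails, as the homomorphism from the symmetric group on four points onto that on three points
  shows.\<close>

lemma tr_disjoint_collapse:
  assumes n: "n \<ge> 5" and "a \<in> {1..n}" "b \<in> {1..n}" "a \<noteq> b" "c \<in> {1..n}" "d \<in> {1..n}" "c \<noteq> d"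
    and disj: "{a, b} \<inter> {c, d} = {}" and eq: "tr a b = tr c d"
  shows "r 1 = r 2"
proof -
  have "card {a, b, c, d} \<le> 4" by (simp add: card_insert_if)
  then have "\<not> {1..n} \<subseteq> {a, b, c, d}" using n card_mono[of "{a, b, c, d}" "{1..n}"] by auto
  then obtain e where e: "e \<in> {1..n}" "e \<notin> {a, b, c, d}" by blast
  have "tr a e = tr c d"
    using tr_eq_transpose[of b e a b c d] assms e by (auto simp: transpose_def)
  then have "tr a b = tr a e" using eq by simp
  then show ?thesis using n assms e by (intro tr_overlap_collapse[of a b e]) auto
qed

lemma tr_inj:
  assumes n: "n \<ge> 5" and ne: "r 1 \<noteq> r 2"
    and ab: "a \<in> {1..n}" "b \<in> {1..n}" "a \<noteq> b" and cd: "c \<in> {1..n}" "d \<in> {1..n}" "c \<noteq> d"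
    and eq: "tr a b = tr c d"
  shows "{a, b} = {c, d}"
proof (rule ccontr)
  assume neq: "{a, b} \<noteq> {c, d}"
  have no: False if "p \<in> {1..n}" "q \<in> {1..n}" "u \<in> {1..n}" "p \<noteq> q" "p \<noteq> u" "q \<noteq> u"
    "tr p q = tr p u" for p q u
    using tr_overlap_collapse[of p q u] that n ne by auto
  have "{a, b} \<inter> {c, d} \<noteq> {}" using tr_disjoint_collapse[OF n ab cd _ eq] ne by blast
  then consider "a = c" | "a = d" | "b = c" | "b = d" by blast
  then show False
  proof cases
    case 1
    then show ?thesis using no[of a b d] ab cd neq eq by auto
  next
    case 2
    then show ?thesis using no[of a b c] ab cd neq eq tr_sym[of c d] by auto
  next
    case 3
    then show ?thesis using no[of b a d] ab cd neq eq tr_sym[of a b] by auto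
  next
    case 4
    then show ?thesis using no[of b a c] ab cd neq eq tr_sym[of a b] tr_sym[of c d] by auto
  qed
qed

lemma fact_le_order:
  assumes n: "n \<ge> 5" and ne: "r 1 \<noteq> r 2" and fin: "finite (carrier G)"
  shows "fact n \<le> order G"
proof -
  let ?S = "{p. p permutes {1..n}}"
  obtain X where X: "\<And>p. p permutes {1..n} \<Longrightarrow> X p \<in> carrier G \<and>
    (\<forall>a \<in> {1..n}. \<forall>b \<in> {1..n}. a \<noteq> b \<longrightarrow> X p \<otimes> tr a b \<otimes> inv (X p) = tr (p a) (p b))"
    using conjugation_realizes_permutation by metis
  have "inj_on X ?S"
  proof (rule inj_onI)
    fix p q assume "p \<in> ?S" "q \<in> ?S" and eq: "X p = X q"
    then have p: "p permutes {1..n}" and q: "q permutes {1..n}" by auto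
    show "p = q"
    proof (rule permutation_eq_of_doubletons[OF _ p q])
      fix a b assume ab: "a \<in> {1..n}" "b \<in> {1..n}" "a \<noteq> b"
      have "tr (p a) (p b) = tr (q a) (q b)" using X[OF p] X[OF q] ab eq by metis
      then show "{p a, p b} = {q a, q b}"
        using ab permutes_in_image[OF p] permutes_in_image[OF q]
          permutes_inj[OF p] permutes_inj[OF q]
        by (intro tr_inj[OF n ne]) (auto simp: inj_eq)
    qed (use n in simp)
  qed
  then have "card ?S \<le> card (carrier G)" using X by (intro card_inj_on_le[OF _ _ fin]) auto
  then show ?thesis using card_permutations[of "{1..n}" n] by (simp add: order_def)
qed

text \<open>If \<open>r j = r (Suc j)\<close>, then \<open>r (Suc j)\<close> commutes with \<open>r (Suc (Suc j))\<close>, and commuting involutions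
  that satisfy the braid relation agree.\<close>

lemma r_eq_of_first_two:
  assumes "r 1 = r 2" and "1 \<le> i" and "i < n"
  shows "r i = r 1"
proof -
  have "r (Suc j) = r 1 \<and> r j = r 1" if "1 \<le> j" "Suc j < n" for j
    using that
  proof (induction j rule: dec_induct)
    case base
    then show ?case using assms by (simp add: numeral_2_eq_2)
  next
    case (step j)
    let ?x = "r (Suc j)" let ?y = "r (Suc (Suc j))"
    have xj: "?x = r j" "?x = r 1" using step by auto
    have "r j \<otimes> ?y = ?y \<otimes> r j" using step by (intro r_far) auto
    then have c: "?x \<otimes> ?y = ?y \<otimes> ?x" unfolding xj(1) .
    have b: "?x \<otimes> ?y \<otimes> ?x = ?y \<otimes> ?x \<otimes> ?y" using step by (intro r_braid) auto
    have xy: "?x \<in> carrier G" "?y \<in> carrier G" using step by auto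
    have sq: "?x \<otimes> ?x = \<one>" "?y \<otimes> ?y = \<one>" using step by (auto intro: r_square)
    have "?x = ?x \<otimes> ?y \<otimes> ?y" using xy sq by (simp only: m_assoc r_one)
    also have "\<dots> = ?x \<otimes> ?y \<otimes> ?x" by (simp only: b[symmetric] c)
    also have "\<dots> = ?y" using xy sq by (simp only: c m_assoc r_one)
    finally show ?case using xj by simp
  qed
  from this[of "i - 1"] show ?thesis using assms by (cases "i = 1") auto
qed

text \<open>By the braid relation, \<open>r (Suc i) \<otimes> r i\<close> has order dividing 3, so its inverse \<open>r i \<otimes> r (Suc i)\<close>
  is its square, and the square of a product of two involutions is their commutator.\<close>

lemma r_product_in_derived:
  assumes i: "1 \<le> i" "Suc i < n"
  shows "r i \<otimes> r (Suc i) \<in> derived G (carrier G)"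
proof -
  let ?x = "r i" let ?y = "r (Suc i)"
  have "?y \<otimes> ?x \<otimes> inv ?y \<otimes> inv ?x \<in> derived G (carrier G)"
    unfolding derived_def using i by (intro generate.incl UN_I[of ?y] UN_I[of ?x]) auto
  also have "?y \<otimes> ?x \<otimes> inv ?y \<otimes> inv ?x = (?y \<otimes> ?x \<otimes> ?y) \<otimes> ?x" using i by (simp add: inv_r)
  also have "\<dots> = (?x \<otimes> ?y \<otimes> ?x) \<otimes> ?x" using i by (simp add: r_braid)
  also have "\<dots> = ?x \<otimes> ?y" using i by (simp add: m_assoc r_square)
  finally show ?thesis .
qed

text \<open>The two elements whose commutation is used are \<open>r 1 \<otimes> r 2\<close> and \<open>r 1 \<otimes> r 4\<close>: as \<open>r 4\<close> commutes with
  \<open>r 1\<close> and \<open>r 2\<close>, it cancels and leaves that \<open>r 1\<close> and \<open>r 2\<close> commute.\<close>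

lemma first_two_eq_of_derived_commutes:
  assumes n: "n \<ge> 5"
    and comm: "\<And>x y. x \<in> derived G (carrier G) \<Longrightarrow> y \<in> derived G (carrier G) \<Longrightarrow> x \<otimes> y = y \<otimes> x"
  shows "r 1 = r 2"
proof -
  have c: "r 1 \<in> carrier G" "r 2 \<in> carrier G" "r 3 \<in> carrier G" "r 4 \<in> carrier G"
    using n by auto
  have sq: "r 1 \<otimes> r 1 = \<one>" "r 2 \<otimes> r 2 = \<one>" "r 3 \<otimes> r 3 = \<one>"
    using n by (auto intro: r_square)
  have p: "r 1 \<otimes> r 2 \<in> derived G (carrier G)" "r 2 \<otimes> r 3 \<in> derived G (carrier G)"
    "r 3 \<otimes> r 4 \<in> derived G (carrier G)"
    using r_product_in_derived[of 1] r_product_in_derived[of 2] r_product_in_derived[of 3] n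
    by (auto simp: numeral_eq_Suc)
  have "r 1 \<otimes> r 4 = (r 1 \<otimes> r 2) \<otimes> ((r 2 \<otimes> r 3) \<otimes> (r 3 \<otimes> r 4))"
    using c n by (simp add: m_assoc r_cancel)
  also have "\<dots> \<in> derived G (carrier G)"
    using p subgroup.m_closed[OF derived_is_subgroup[OF subset_refl]] by blast
  finally have "(r 1 \<otimes> r 2) \<otimes> (r 1 \<otimes> r 4) = (r 1 \<otimes> r 4) \<otimes> (r 1 \<otimes> r 2)"
    using comm p by blast
  then have "r 2 \<otimes> r 1 \<otimes> r 4 = r 4 \<otimes> r 1 \<otimes> r 2" using c by (simp add: m_assoc)
  also have "\<dots> = r 1 \<otimes> (r 4 \<otimes> r 2)" using r_far[of 1 4] n c by (simp add: m_assoc[symmetric])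
  also have "\<dots> = r 1 \<otimes> r 2 \<otimes> r 4" using r_far[of 2 4] n c by (simp add: m_assoc)
  finally have c21: "r 2 \<otimes> r 1 = r 1 \<otimes> r 2" using c by simp
  have "r 1 \<otimes> r 2 \<otimes> r 1 = r 2 \<otimes> r 1 \<otimes> r 2"
    using r_braid[of 1] n by (simp add: numeral_2_eq_2)
  also have "\<dots> = r 1 \<otimes> r 2 \<otimes> r 2" by (simp only: c21)
  finally show ?thesis using c by simp
qed

end


section \<open>Quotients of universal virtual braid groups\<close>

lemma (in group) comm_group_of_generators:
  assumes S: "S \<subseteq> carrier G" and gen: "generate G S = carrier G"
    and comm: "\<And>x y. x \<in> S \<Longrightarrow> y \<in> S \<Longrightarrow> x \<otimes> y = y \<otimes> x"
  shows "comm_group G"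
proof -
  have extend: "x \<otimes> z = z \<otimes> x"
    if x: "x \<in> generate G S" and z: "z \<in> carrier G" and zS: "\<And>y. y \<in> S \<Longrightarrow> y \<otimes> z = z \<otimes> y" for x z
    using x
  proof induction
    case one
    then show ?case using z by simp
  next
    case (incl h)
    then show ?case by (rule zS)
  next
    case (inv h)
    then have h: "h \<in> carrier G" using S by blast
    have "inv h \<otimes> z = inv h \<otimes> (z \<otimes> h) \<otimes> inv h" using h z by (simp add: m_assoc)
    also have "\<dots> = inv h \<otimes> (h \<otimes> z) \<otimes> inv h" using zS[OF inv] by simp
    also have "\<dots> = z \<otimes> inv h" using h z by (simp add: m_assoc[symmetric])
    finally show ?case .
  next
    case (eng a b)
    then have c: "a \<in> carrier G" "b \<in> carrier G" using gen by auto
    have "a \<otimes> b \<otimes> z = a \<otimes> (z \<otimes> b)" using c z eng by (simp add: m_assoc)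
    also have "\<dots> = z \<otimes> (a \<otimes> b)" using c z eng by (simp add: m_assoc[symmetric])
    finally show ?case .
  qed
  show ?thesis
  proof (rule group_comm_groupI)
    fix x y assume "x \<in> carrier G" "y \<in> carrier G"
    then show "x \<otimes> y = y \<otimes> x"
      using extend[of x y] extend[of y] S gen comm by (metis subsetD)
  qed
qed

lemma (in normal) group_hom_Mod: "group_hom G (G Mod H) ((#>) H)"
  by (simp add: group_hom.intro group_hom_axioms.intro factorgroup_is_group r_coset_hom_Mod is_group)

lemma (in normal) generate_Mod:
  assumes "S \<subseteq> carrier G" "generate G S = carrier G"
  shows "generate (G Mod H) ((#>) H ` S) = carrier (G Mod H)"
  using group_hom.generate_img[OF group_hom_Mod assms(1)] assms(2) by (simp add: carrier_FactGroup)

lemma (in normal) rcos_eqI: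
  assumes a: "a \<in> carrier G" and b: "b \<in> carrier G" and "a \<otimes> inv b \<in> H"
  shows "H #> a = H #> b"
proof -
  have "a = (a \<otimes> inv b) \<otimes> b" using a b by (simp add: m_assoc)
  then have "a \<in> H #> b" using rcosI[OF assms(3) subset b] by simp
  then show ?thesis using repr_independence[OF _ b] subgroup_axioms by simp
qed

text \<open>The families of relations are set comprehensions over up to four indices; these rules transport
  each of them along a homomorphism.\<close>

lemma Collect_image:
  "(\<And>i. P i \<Longrightarrow> F i = g (f i)) \<Longrightarrow> {F i | i. P i} = g ` {f i | i. P i}"
  "(\<And>i j. P' i j \<Longrightarrow> F' i j = g (f' i j)) \<Longrightarrow> {F' i j | i j. P' i j} = g ` {f' i j | i j. P' i j}"
  "(\<And>i j t. P3 i j t \<Longrightarrow> F3 i j t = g (f3 i j t)) \<Longrightarrow>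
    {F3 i j t | i j t. P3 i j t} = g ` {f3 i j t | i j t. P3 i j t}"
  "(\<And>i j t l. P4 i j t l \<Longrightarrow> F4 i j t l = g (f4 i j t l)) \<Longrightarrow>
    {F4 i j t l | i j t l. P4 i j t l} = g ` {f4 i j t l | i j t l. P4 i j t l}"
  by (force simp: image_iff)+

lemma (in normal) Mod_commute:
  assumes a: "a \<in> carrier G" and b: "b \<in> carrier G" and "a \<otimes> b \<otimes> inv a \<otimes> inv b \<in> H"
  shows "(H #> a) \<otimes>\<^bsub>G Mod H\<^esub> (H #> b) = (H #> b) \<otimes>\<^bsub>G Mod H\<^esub> (H #> a)"
proof -
  have "(a \<otimes> b) \<otimes> inv (b \<otimes> a) \<in> H" using assms by (simp add: inv_mult_group m_assoc)
  then have "H #> (a \<otimes> b) = H #> (b \<otimes> a)" using a b by (intro rcos_eqI m_closed)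
  then show ?thesis using a b by (simp add: rcos_sum)
qed

lemma (in group_hom) uv_relations_image:
  assumes "\<And>i. i \<in> {1..n-1} \<Longrightarrow> r i \<in> carrier G"
    and "\<And>i t. i \<in> {1..n-1} \<Longrightarrow> t \<in> {1..k} \<Longrightarrow> s i t \<in> carrier G"
  shows "uv_relations H n k (\<lambda>i. h (r i)) (\<lambda>i t. h (s i t))
      = map_prod h h ` uv_relations G n k r s"
    and "forbidden_relations H n k (\<lambda>i. h (r i)) (\<lambda>i t. h (s i t))
      = map_prod h h ` forbidden_relations G n k r s"
proof -
  have next_in: "i \<in> {1..n-1} \<and> i + 1 \<in> {1..n-1}" if "i \<in> {1..n-2}" for i
    using that by auto
  note closed = assms next_in
  show "uv_relations H n k (\<lambda>i. h (r i)) (\<lambda>i t. h (s i t))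
      = map_prod h h ` uv_relations G n k r s"
    unfolding uv_relations_def image_Un
    by (intro arg_cong2[where f = "(\<union>)"] Collect_image;
        simp add: closed del: atLeastAtMost_iff One_nat_def)
  show "forbidden_relations H n k (\<lambda>i. h (r i)) (\<lambda>i t. h (s i t))
      = map_prod h h ` forbidden_relations G n k r s"
    unfolding forbidden_relations_def image_Un
    by (intro arg_cong2[where f = "(\<union>)"] Collect_image;
        simp add: closed del: atLeastAtMost_iff One_nat_def)
qed

text \<open>The quotients of \<open>UV\<^sub>n(k)\<close>, described by the images of the generators.\<close>

locale uv_group = group G for G (structure) +
  fixes n k :: nat and r :: "nat \<Rightarrow> 'a" and s :: "nat \<Rightarrow> nat \<Rightarrow> 'a"
  assumes rho_closed: "i \<in> {1..n-1} \<Longrightarrow> r i \<in> carrier G"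
    and sig_closed: "i \<in> {1..n-1} \<Longrightarrow> t \<in> {1..k} \<Longrightarrow> s i t \<in> carrier G"
    and relations: "(a, b) \<in> uv_relations G n k r s \<Longrightarrow> a = b"
    and generated: "generate G (case_uv_gen r s ` uv_gens n k) = carrier G"
begin

lemma rho_square: "i \<in> {1..n-1} \<Longrightarrow> r i \<otimes> r i = \<one>"
  by (rule relations) (unfold uv_relations_def, blast)

lemma rho_braid:
  "i \<in> {1..n-2} \<Longrightarrow> r i \<otimes> r (i+1) \<otimes> r i = r (i+1) \<otimes> r i \<otimes> r (i+1)"
  by (rule relations) (unfold uv_relations_def, blast)

lemma rho_far:
  "i \<in> {1..n-1} \<Longrightarrow> j \<in> {1..n-1} \<Longrightarrow> \<bar>int i - int j\<bar> \<ge> 2 \<Longrightarrow> r i \<otimes> r j = r j \<otimes> r i"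
  by (rule relations) (unfold uv_relations_def, blast)

lemma sig_far:
  "i \<in> {1..n-1} \<Longrightarrow> j \<in> {1..n-1} \<Longrightarrow> \<bar>int i - int j\<bar> \<ge> 2 \<Longrightarrow> t \<in> {1..k} \<Longrightarrow> l \<in> {1..k} \<Longrightarrow>
    s i t \<otimes> s j l = s j l \<otimes> s i t"
  by (rule relations) (unfold uv_relations_def, blast)

lemma sig_rho_far:
  "i \<in> {1..n-1} \<Longrightarrow> j \<in> {1..n-1} \<Longrightarrow> \<bar>int i - int j\<bar> \<ge> 2 \<Longrightarrow> t \<in> {1..k} \<Longrightarrow>
    s i t \<otimes> r j = r j \<otimes> s i t"
  by (rule relations) (unfold uv_relations_def, blast)

lemma sig_shift:
  "i \<in> {1..n-2} \<Longrightarrow> t \<in> {1..k} \<Longrightarrow>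
    r i \<otimes> r (i+1) \<otimes> s i t = s (i+1) t \<otimes> r i \<otimes> r (i+1)"
  by (rule relations) (unfold uv_relations_def, blast)

sublocale coxeter_type_A G n r
proof
  show "r i \<otimes> r (Suc i) \<otimes> r i = r (Suc i) \<otimes> r i \<otimes> r (Suc i)" if "1 \<le> i" "Suc i < n" for i
    using rho_braid[of i] that by simp
  show "r i \<otimes> r j = r j \<otimes> r i" if "1 \<le> i" "Suc i < j" "j < n" for i j
    using that by (intro rho_far) auto
qed (auto intro!: rho_closed rho_square)

lemma gens_closed: "case_uv_gen r s ` uv_gens n k \<subseteq> carrier G"
  by (auto simp: uv_gens_def intro!: rho_closed sig_closed)

lemma image_uv_gensE:
  assumes "x \<in> case_uv_gen r s ` uv_gens n k"
  obtains i where "i \<in> {1..n-1}" "x = r i"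
    | i t where "i \<in> {1..n-1}" "t \<in> {1..k}" "x = s i t"
  using assms unfolding uv_gens_def by force

text \<open>With all \<open>r i\<close> equal to one involution, \<open>sig_shift\<close> says \<open>s i t = s (i+1) t\<close>. Any two generators
  may then be given the indices \<open>1\<close> and \<open>3\<close>, for which commutation is a defining relation.\<close>

lemma comm_group_of_first_two_eq:
  assumes n: "n \<ge> 5" and eq: "r 1 = r 2"
  shows "comm_group G"
proof (rule comm_group_of_generators[OF gens_closed generated])
  have r: "r i = r 1" if "i \<in> {1..n-1}" for i
    using that by (intro r_eq_of_first_two[OF eq]) auto
  have r1: "r 1 \<in> carrier G" "r 1 \<otimes> r 1 = \<one>" using n by (auto intro!: rho_closed rho_square)
  have s: "s i t = s 1 t" if "i \<in> {1..n-1}" "t \<in> {1..k}" for i t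
  proof -
    have "1 \<le> i" "i \<le> n - 1" using that by auto
    then show ?thesis
    proof (induction i rule: dec_induct)
      case (step j)
      have c: "s j t \<in> carrier G" "s (j+1) t \<in> carrier G"
        using step that by (auto intro!: sig_closed)
      have "r 1 \<otimes> r 1 \<otimes> s j t = s (j+1) t \<otimes> r 1 \<otimes> r 1"
        using sig_shift[of j t] step that r[of j] r[of "j+1"] by auto
      then have "s j t = s (j+1) t" using c r1 by (simp add: m_assoc)
      then show ?case using step by simp
    qed simp
  qed
  have in3: "1 \<in> {1..n-1}" "3 \<in> {1..n-1}" using n by auto
  have rs: "s i t \<otimes> r j = r j \<otimes> s i t"
    if "i \<in> {1..n-1}" "j \<in> {1..n-1}" "t \<in> {1..k}" for i j t
    unfolding s[OF that(1,3)] r[OF that(2)]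
    using sig_rho_far[OF in3 _ that(3)] unfolding r[OF in3(2)] by simp
  have ss: "s i t \<otimes> s j l = s j l \<otimes> s i t"
    if "i \<in> {1..n-1}" "j \<in> {1..n-1}" "t \<in> {1..k}" "l \<in> {1..k}" for i j t l
    unfolding s[OF that(1,3)] s[OF that(2,4)]
    using sig_far[OF in3 _ that(3,4)] unfolding s[OF in3(2) that(4)] by simp
  have rr: "r i \<otimes> r j = r j \<otimes> r i" if "i \<in> {1..n-1}" "j \<in> {1..n-1}" for i j
    unfolding r[OF that(1)] r[OF that(2)] ..
  fix x y assume "x \<in> case_uv_gen r s ` uv_gens n k" "y \<in> case_uv_gen r s ` uv_gens n k"
  then show "x \<otimes> y = y \<otimes> x"
    by (elim image_uv_gensE; simp only: rr rs ss)
qed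

lemma fact_le_order_of_nonabelian:
  assumes "n \<ge> 5" and "finite (carrier G)" and "\<not> comm_group G"
  shows "fact n \<le> order G"
  using fact_le_order comm_group_of_first_two_eq assms by blast

lemma uv_group_Mod:
  assumes N: "N \<lhd> G"
  shows "uv_group (G Mod N) n k (\<lambda>i. N #> r i) (\<lambda>i t. N #> s i t)"
proof -
  interpret N: normal N G by (rule N)
  interpret h: group_hom G "G Mod N" "(#>) N" by (rule N.group_hom_Mod)
  show ?thesis
  proof
    fix a b assume "(a, b) \<in> uv_relations (G Mod N) n k (\<lambda>i. N #> r i) (\<lambda>i t. N #> s i t)"
    then obtain a' b' where "(a', b') \<in> uv_relations G n k r s" "a = N #> a'" "b = N #> b'"
      using h.uv_relations_image(1)[of n r k s] rho_closed sig_closed by auto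
    then show "a = b" using relations by blast
  next
    have "case_uv_gen (\<lambda>i. N #> r i) (\<lambda>i t. N #> s i t) = (#>) N \<circ> case_uv_gen r s"
      by (auto simp: fun_eq_iff split: uv_gen.split)
    then show "generate (G Mod N)
        (case_uv_gen (\<lambda>i. N #> r i) (\<lambda>i t. N #> s i t) ` uv_gens n k) = carrier (G Mod N)"
      using N.generate_Mod[OF gens_closed generated] by (simp add: image_comp)
  qed (simp_all add: rho_closed sig_closed)
qed

text \<open>In the quotient by the second derived subgroup the derived subgroup is abelian, so the quotient
  collapses to an abelian group.\<close>

lemma derived_eq_second_derived:
  assumes n: "n \<ge> 5"
  shows "derived G (derived G (carrier G)) = derived G (carrier G)"
proof
  let ?D = "derived G (carrier G)" let ?N = "derived G ?D"
  have N: "?N \<lhd> G" by (intro derived_is_normal normal_self)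
  have D: "?D \<subseteq> carrier G" by (simp add: derived_in_carrier)
  show "?N \<subseteq> ?D" using D by (intro mono_derived)
  interpret N: normal ?N G by (rule N)
  interpret h: group_hom G "G Mod ?N" "(#>) ?N" by (rule N.group_hom_Mod)
  interpret Q: uv_group "G Mod ?N" n k "\<lambda>i. ?N #> r i" "\<lambda>i t. ?N #> s i t"
    by (rule uv_group_Mod[OF N])
  \<comment> \<open>The derived subgroup of the quotient is the image of the derived subgroup.\<close>
  have QD: "derived (G Mod ?N) (carrier (G Mod ?N)) = (#>) ?N ` ?D"
    using h.derived_img[of "carrier G"] by (simp add: carrier_FactGroup)
  have comm: "x \<otimes>\<^bsub>G Mod ?N\<^esub> y = y \<otimes>\<^bsub>G Mod ?N\<^esub> x"
    if xy: "x \<in> derived (G Mod ?N) (carrier (G Mod ?N))" "y \<in> derived (G Mod ?N) (carrier (G Mod ?N))" for x y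
  proof -
    obtain a where a: "x = ?N #> a" "a \<in> ?D" using xy(1) unfolding QD by (rule imageE)
    obtain b where b: "y = ?N #> b" "b \<in> ?D" using xy(2) unfolding QD by (rule imageE)
    have "a \<otimes> b \<otimes> inv a \<otimes> inv b \<in> derived_set G ?D" using a(2) b(2) by blast
    then have "a \<otimes> b \<otimes> inv a \<otimes> inv b \<in> ?N"
      unfolding derived_def[of G ?D] by (rule generate.incl)
    then show ?thesis
      unfolding a(1) b(1) by (rule N.Mod_commute[OF subsetD[OF D a(2)] subsetD[OF D b(2)]])
  qed
  have "comm_group (G Mod ?N)"
    by (rule Q.comm_group_of_first_two_eq[OF n Q.first_two_eq_of_derived_commutes[OF n comm]])
  then have "derived (G Mod ?N) (carrier (G Mod ?N)) = {\<one>\<^bsub>G Mod ?N\<^esub>}"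
    by (rule comm_group.derived_eq_singleton[OF _ subset_refl])
  then have trivial: "(#>) ?N ` ?D = {?N}" unfolding QD one_FactGroup .
  show "?D \<subseteq> ?N"
  proof
    fix a assume a: "a \<in> ?D"
    have "?N #> a = ?N" using imageI[OF a, of "(#>) ?N"] unfolding trivial by simp
    then show "a \<in> ?N" using rcos_self[OF subsetD[OF D a] N.subgroup_axioms] by simp
  qed
qed

end

lemma (in group) perfect_commutator_subgroup_iff:
  "perfect (commutator_subgroup G)
    \<longleftrightarrow> derived G (derived G (carrier G)) = derived G (carrier G)"
proof -
  let ?D = "derived G (carrier G)"
  have D: "subgroup ?D G" by (simp add: derived_is_subgroup)
  show ?thesis
    using subgroup_imp_group[OF D] derived_consistent[OF subset_refl D]
    by (simp add: perfect_def commutator_subgroup_def)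
qed


section \<open>Universal properties of free groups and imposed relations\<close>

text \<open>The value of a word when its letters stand for given group elements; it induces the homomorphism
  on the free group.\<close>

primrec (in group) word_eval :: "('x \<Rightarrow> 'a) \<Rightarrow> 'x word \<Rightarrow> 'a" where
  "word_eval f [] = \<one>"
| "word_eval f (l # w) = (if snd l then f (fst l) else inv (f (fst l))) \<otimes> word_eval f w"

lemma (in group) word_eval_closed:
  "f \<in> X \<rightarrow> carrier G \<Longrightarrow> u \<in> words X \<Longrightarrow> word_eval f u \<in> carrier G"
  by (induction u) (auto simp: words_def Pi_iff)

lemma (in group) word_eval_append:
  assumes f: "f \<in> X \<rightarrow> carrier G" and "u \<in> words X" and v: "v \<in> words X"
  shows "word_eval f (u @ v) = word_eval f u \<otimes> word_eval f v"
  using assms(2)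
proof (induction u)
  case Nil
  then show ?case using word_eval_closed[OF f v] by simp
next
  case (Cons l u)
  then have u: "u \<in> words X" and l: "f (fst l) \<in> carrier G" using f by (auto simp: words_def)
  show ?case
    using Cons.IH[OF u] l word_eval_closed[OF f u] word_eval_closed[OF f v]
    by (simp add: m_assoc)
qed

lemma (in group) word_eval_cong:
  assumes f: "f \<in> X \<rightarrow> carrier G" and "free_cong X u v"
  shows "word_eval f u = word_eval f v"
  using assms(2)
proof induction
  case (cancel u v x b)
  have x: "f x \<in> carrier G" using f cancel by auto
  have v: "word_eval f v \<in> carrier G" using word_eval_closed[OF f] cancel by blast
  have "[(x, b), (x, \<not> b)] @ v \<in> words X" using cancel by (simp add: words_def)
  then have "word_eval f (u @ [(x, b), (x, \<not> b)] @ v)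
      = word_eval f u \<otimes> word_eval f ([(x, b), (x, \<not> b)] @ v)"
    using word_eval_append[OF f] cancel by blast
  also have "word_eval f ([(x, b), (x, \<not> b)] @ v) = word_eval f v"
    using x v by (cases b) (simp_all flip: m_assoc)
  also have "word_eval f u \<otimes> word_eval f v = word_eval f (u @ v)"
    using word_eval_append[OF f] cancel by simp
  finally show ?case .
qed auto

lemma (in group) free_group_universal:
  assumes f: "f \<in> X \<rightarrow> carrier G"
  obtains h where "h \<in> hom (free_group X) G" "\<And>x. x \<in> X \<Longrightarrow> h (free_gen X x) = f x"
proof
  let ?h = "\<lambda>A. the_elem (word_eval f ` A)"
  have h: "?h (free_rel X `` {u}) = word_eval f u" if "u \<in> words X" for u
    using that word_eval_cong[OF f]
    by (intro the_elem_image_unique) (auto simp: free_rel_def intro: free_cong.refl)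
  show "?h \<in> hom (free_group X) G"
  proof (rule homI)
    fix A assume "A \<in> carrier (free_group X)"
    then obtain u where u: "u \<in> words X" and A: "A = free_rel X `` {u}"
      by (auto simp: free_group_carrier)
    show "?h A \<in> carrier G" using h[OF u] word_eval_closed[OF f u] A by simp
    fix B assume "B \<in> carrier (free_group X)"
    then obtain v where v: "v \<in> words X" and B: "B = free_rel X `` {v}"
      by (auto simp: free_group_carrier)
    have "u @ v \<in> words X" using u v by (simp add: words_append_iff)
    then show "?h (A \<otimes>\<^bsub>free_group X\<^esub> B) = ?h A \<otimes> ?h B"
      using h u v by (simp add: A B free_group_mult word_eval_append[OF f])
  qed
  show "?h (free_gen X x) = f x" if "x \<in> X" for x
  proof -
    have "[(x, True)] \<in> words X" using that by (simp add: words_def)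
    moreover have "f x \<in> carrier G" using f that by blast
    ultimately show ?thesis using h[of "[(x, True)]"] by (simp add: free_gen_def)
  qed
qed

text \<open>By induction on words, since the class of a formal inverse is the inverse of the class of the
  generator.\<close>

lemma generate_free_group: "generate (free_group X) (free_gen X ` X) = carrier (free_group X)"
proof
  let ?F = "free_group X"
  have one: "\<one>\<^bsub>?F\<^esub> = free_rel X `` {[]}" by (simp add: free_group_def)
  interpret group "free_group X" by (rule group_free_group)
  have S: "free_gen X ` X \<subseteq> carrier (free_group X)"
    by (rule image_subsetI[OF free_gen_in_carrier])
  show "generate (free_group X) (free_gen X ` X) \<subseteq> carrier (free_group X)"
    by (rule generate_incl[OF S])
  have "free_rel X `` {u} \<in> generate (free_group X) (free_gen X ` X)" if "u \<in> words X" for u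
    using that
  proof (induction u)
    case Nil
    show ?case using generate.one[of ?F "free_gen X ` X"] unfolding one .
  next
    case (Cons l u)
    obtain x c where l: "l = (x, c)" by (rule prod.exhaust)
    have u: "u \<in> words X" and x: "x \<in> X" using Cons.prems by (simp_all add: words_def l)
    have letter: "[(x, b)] \<in> words X" for b using x by (simp add: words_def)
    have "free_cong X ([] @ [(x, False), (x, \<not> False)] @ []) ([] @ [])"
      using x by (intro free_cong.cancel) (auto simp: words_def)
    then have "([(x, False), (x, True)], []) \<in> free_rel X" by (simp add: free_rel_def)
    then have "free_rel X `` {[(x, False), (x, True)]} = free_rel X `` {[]}"
      by (rule equiv_class_eq[OF equiv_free_rel])
    then have "free_rel X `` {[(x, False)]} \<otimes>\<^bsub>?F\<^esub> free_gen X x = \<one>\<^bsub>?F\<^esub>"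
      unfolding one free_gen_def free_group_mult[OF letter letter] by simp
    moreover have "free_rel X `` {[(x, False)]} \<in> carrier ?F"
      unfolding free_group_carrier by (rule bexI[OF _ letter[of False]]) simp
    ultimately have inv: "inv\<^bsub>?F\<^esub> free_gen X x = free_rel X `` {[(x, False)]}"
      by (rule inv_equality[OF _ free_gen_in_carrier[OF x]])
    have gen: "free_gen X x \<in> free_gen X ` X" using x by blast
    have "free_rel X `` {[(x, c)]} \<in> generate ?F (free_gen X ` X)"
      using generate.incl[OF gen, of ?F] generate.inv[OF gen, of ?F, unfolded inv]
      by (cases c) (simp_all add: free_gen_def[of X x])
    then have "free_rel X `` {[(x, c)]} \<otimes>\<^bsub>?F\<^esub> free_rel X `` {u} \<in> generate ?F (free_gen X ` X)"
      using Cons.IH[OF u] by (rule generate.eng)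
    then show ?case unfolding l free_group_mult[OF letter u] by simp
  qed
  then show "carrier ?F \<subseteq> generate ?F (free_gen X ` X)"
    unfolding subset_iff free_group_carrier by blast
qed

lemma (in group) relation_closure_contains:
  "(a, b) \<in> R \<Longrightarrow> a \<otimes> inv b \<in> relation_closure G R"
  unfolding relation_closure_def normal_closure_def by blast

lemma (in group) relation_closure_coset_eq:
  assumes "R \<subseteq> carrier G \<times> carrier G" and "(a, b) \<in> R"
  shows "relation_closure G R #> a = relation_closure G R #> b"
  using normal.rcos_eqI[OF relation_closure_normal[OF assms(1)]] relation_closure_contains assms
  by blast

text \<open>A homomorphism that respects the relations has all relators in its kernel, which is normal and
  therefore contains the normal closure.\<close>

lemma (in group_hom) impose_universal:
  assumes R: "R \<subseteq> carrier G \<times> carrier G" and eq: "\<And>a b. (a, b) \<in> R \<Longrightarrow> h a = h b"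
  obtains g where "g \<in> hom (impose G R) H"
    "\<And>x. x \<in> carrier G \<Longrightarrow> g (relation_closure G R #> x) = h x"
proof -
  have "{a \<otimes> inv b | a b. (a, b) \<in> R} \<subseteq> kernel G H h"
    using R eq by (auto simp: kernel_def)
  then have "relation_closure G R \<subseteq> kernel G H h"
    unfolding relation_closure_def normal_closure_def using normal_kernel by blast
  then show ?thesis
    using FactGroup_universal_kernel[OF G.relation_closure_normal[OF R]] that
    unfolding impose_def by blast
qed


section \<open>The unrestricted group and its map onto the symmetric group\<close>

lemma uv_group_UV: "uv_group (UV n k) n k (\<lambda>i. UV_gen n k (Rho i)) (\<lambda>i t. UV_gen n k (Sig i t))"
proof -
  let ?X = "uv_gens n k" let ?F = "free_group ?X" let ?R = "UV_free_relations n k"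
  let ?K = "relation_closure ?F ?R"
  interpret F: group ?F by (rule group_free_group)
  interpret K: normal ?K ?F by (intro F.relation_closure_normal UV_free_relations_carrier)
  interpret h: group_hom ?F "UV n k" "(#>\<^bsub>?F\<^esub>) ?K"
    using K.group_hom_Mod by (simp add: UV_def impose_def)
  have gen_in: "Rho i \<in> ?X" if "i \<in> {1..n-1}" for i using that by (auto simp: uv_gens_def)
  have sig_in: "Sig i t \<in> ?X" if "i \<in> {1..n-1}" "t \<in> {1..k}" for i t
    using that by (auto simp: uv_gens_def)
  have image: "uv_relations (UV n k) n k (\<lambda>i. UV_gen n k (Rho i)) (\<lambda>i t. UV_gen n k (Sig i t))
      = map_prod ((#>\<^bsub>?F\<^esub>) ?K) ((#>\<^bsub>?F\<^esub>) ?K) ` ?R"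
    using h.uv_relations_image(1)[OF free_gen_in_carrier[OF gen_in] free_gen_in_carrier[OF sig_in]]
    unfolding UV_gen_def UV_free_relations_def .
  show ?thesis
  proof
    fix a b
    assume "(a, b) \<in> uv_relations (UV n k) n k
      (\<lambda>i. UV_gen n k (Rho i)) (\<lambda>i t. UV_gen n k (Sig i t))"
    then show "a = b"
      unfolding image using F.relation_closure_coset_eq[OF UV_free_relations_carrier] by auto
  next
    have "case_uv_gen (\<lambda>i. UV_gen n k (Rho i)) (\<lambda>i t. UV_gen n k (Sig i t))
        = (#>\<^bsub>?F\<^esub>) ?K \<circ> free_gen ?X"
      by (auto simp: fun_eq_iff UV_gen_def split: uv_gen.split)
    then show "generate (UV n k)
        (case_uv_gen (\<lambda>i. UV_gen n k (Rho i)) (\<lambda>i t. UV_gen n k (Sig i t)) ` ?X)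
        = carrier (UV n k)"
      using K.generate_Mod[OF image_subsetI[OF free_gen_in_carrier] generate_free_group]
      by (simp add: image_comp UV_def impose_def)
  qed (use gen_in sig_in in \<open>auto intro: UV_gen_in_carrier\<close>)
qed

abbreviation UUV_relations where
  "UUV_relations n k \<equiv> forbidden_relations (UV n k) n k
     (\<lambda>i. UV_gen n k (Rho i)) (\<lambda>i t. UV_gen n k (Sig i t))"

definition UUV_gen where
  "UUV_gen n k x = relation_closure (UV n k) (UUV_relations n k) #>\<^bsub>UV n k\<^esub> UV_gen n k x"

lemma UUV_relations_carrier: "UUV_relations n k \<subseteq> carrier (UV n k) \<times> carrier (UV n k)"
  by (intro group.uv_relations_carrier group_UV UV_gen_in_carrier) (auto simp: uv_gens_def)

lemma uv_group_UUV:
  "uv_group (UUV n k) n k (\<lambda>i. UUV_gen n k (Rho i)) (\<lambda>i t. UUV_gen n k (Sig i t))"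
  unfolding UUV_gen_def UUV_def impose_def
  by (intro uv_group.uv_group_Mod uv_group_UV group.relation_closure_normal group_UV
      UUV_relations_carrier)

lemma UUV_gen_in_carrier: "x \<in> uv_gens n k \<Longrightarrow> UUV_gen n k x \<in> carrier (UUV n k)"
  unfolding UUV_gen_def UUV_def impose_def carrier_FactGroup by (intro imageI UV_gen_in_carrier)

text \<open>When \<open>\<rho>\<^sub>i\<close> and \<open>\<sigma>\<^sub>i\<^sub>,\<^sub>t\<close> have the same value, the forbidden relations and the mixed relation both
  become the braid relation.\<close>

lemma sym_group_relations:
  assumes r: "\<And>i. i \<in> {1..n-1} \<Longrightarrow> r i = transpose i (Suc i)"
    and s: "\<And>i t. i \<in> {1..n-1} \<Longrightarrow> t \<in> {1..k} \<Longrightarrow> s i t = transpose i (Suc i)"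
  shows "(a, b) \<in> uv_relations (sym_group n) n k r s \<Longrightarrow> a = b"
    and "(a, b) \<in> forbidden_relations (sym_group n) n k r s \<Longrightarrow> a = b"
proof -
  have far: "transpose i (Suc i) \<circ> transpose j (Suc j) = transpose j (Suc j) \<circ> transpose i (Suc i)"
    if "\<bar>int i - int j\<bar> \<ge> 2" for i j
    using that by (auto simp: fun_eq_iff transpose_def)
  have braid: "transpose i (Suc i) \<circ> transpose (i + 1) (Suc (i + 1)) \<circ> transpose i (Suc i)
      = transpose (i + 1) (Suc (i + 1)) \<circ> transpose i (Suc i) \<circ> transpose (i + 1) (Suc (i + 1))" for i
    by (auto simp: fun_eq_iff transpose_def)
  have next_in: "i \<in> {1..n-1} \<and> i + 1 \<in> {1..n-1}" if "i \<in> {1..n-2}" for i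
    using that by auto
  show "(a, b) \<in> uv_relations (sym_group n) n k r s \<Longrightarrow> a = b"
    unfolding uv_relations_def sym_group_mult sym_group_one
    by (elim UnE CollectE exE conjE;
        simp add: r s next_in far braid del: atLeastAtMost_iff One_nat_def)
  show "(a, b) \<in> forbidden_relations (sym_group n) n k r s \<Longrightarrow> a = b"
    unfolding forbidden_relations_def sym_group_mult
    by (elim UnE CollectE exE conjE;
        simp add: r s next_in braid del: atLeastAtMost_iff One_nat_def)
qed

text \<open>The assignment \<open>\<rho>\<^sub>i, \<sigma>\<^sub>i\<^sub>,\<^sub>t \<mapsto> (i i+1)\<close> is extended to the free group and passes to the two
  successive quotients; it is onto because adjacent transpositions generate the symmetric group.\<close>

lemma UUV_onto_sym_group:
  obtains h where "group_hom (UUV n k) (sym_group n) h"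
    and "h ` carrier (UUV n k) = carrier (sym_group n)"
proof -
  let ?X = "uv_gens n k" let ?F = "free_group ?X" let ?S = "sym_group n"
  let ?t = "\<lambda>i. transpose i (Suc i)"
  interpret S: group ?S by (rule sym_group_is_group)
  interpret F: group ?F by (rule group_free_group)
  interpret UV: group "UV n k" by (rule group_UV)
  interpret UUV: group "UUV n k" by (rule group_UUV)
  have rho_in: "Rho i \<in> ?X" if "i \<in> {1..n-1}" for i using that by (auto simp: uv_gens_def)
  have sig_in: "Sig i t \<in> ?X" if "i \<in> {1..n-1}" "t \<in> {1..k}" for i t
    using that by (auto simp: uv_gens_def)
  have "case_uv_gen ?t (\<lambda>i t. ?t i) \<in> ?X \<rightarrow> carrier ?S"
    by (auto simp: uv_gens_def sym_group_carrier intro!: permutes_swap_id)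
  then obtain f where f: "f \<in> hom ?F ?S"
    and fg: "\<And>x. x \<in> ?X \<Longrightarrow> f (free_gen ?X x) = case_uv_gen ?t (\<lambda>i t. ?t i) x"
    by (rule S.free_group_universal) (rule that)
  interpret f: group_hom ?F ?S f by unfold_locales (rule f)
  have f_rel: "f a = f b" if "(a, b) \<in> UV_free_relations n k" for a b
  proof (rule sym_group_relations(1))
    show "(f a, f b) \<in> uv_relations ?S n k
        (\<lambda>i. f (free_gen ?X (Rho i))) (\<lambda>i t. f (free_gen ?X (Sig i t)))"
      using imageI[OF that, of "map_prod f f"] unfolding UV_free_relations_def
      by (subst f.uv_relations_image(1)) (simp_all only: free_gen_in_carrier rho_in sig_in map_prod_simp)
  qed (simp_all only: fg rho_in sig_in uv_gen.case)
  obtain g where g: "g \<in> hom (UV n k) ?S"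
    and gf: "\<And>x. x \<in> carrier ?F \<Longrightarrow>
      g (relation_closure ?F (UV_free_relations n k) #>\<^bsub>?F\<^esub> x) = f x"
    by (rule f.impose_universal[OF UV_free_relations_carrier f_rel, folded UV_def]) (assumption, rule that)
  interpret g: group_hom "UV n k" ?S g by unfold_locales (rule g)
  have gg: "g (UV_gen n k x) = case_uv_gen ?t (\<lambda>i t. ?t i) x" if "x \<in> ?X" for x
    using gf[OF free_gen_in_carrier[OF that]] fg[OF that] by (simp only: UV_gen_def)
  have g_rel: "g a = g b" if "(a, b) \<in> UUV_relations n k" for a b
  proof (rule sym_group_relations(2))
    show "(g a, g b) \<in> forbidden_relations ?S n k
        (\<lambda>i. g (UV_gen n k (Rho i))) (\<lambda>i t. g (UV_gen n k (Sig i t)))"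
      using imageI[OF that, of "map_prod g g"]
      by (subst g.uv_relations_image(2)) (simp_all only: UV_gen_in_carrier rho_in sig_in map_prod_simp)
  qed (simp_all only: gg rho_in sig_in uv_gen.case)
  obtain h where h: "h \<in> hom (UUV n k) ?S"
    and hg: "\<And>x. x \<in> carrier (UV n k) \<Longrightarrow>
      h (relation_closure (UV n k) (UUV_relations n k) #>\<^bsub>UV n k\<^esub> x) = g x"
    by (rule g.impose_universal[OF UUV_relations_carrier g_rel, folded UUV_def]) (assumption, rule that)
  interpret h: group_hom "UUV n k" ?S h by unfold_locales (rule h)
  have ht: "?t i \<in> h ` carrier (UUV n k)" if "1 \<le> i" "i < n" for i
  proof -
    have i: "Rho i \<in> ?X" using that by (intro rho_in) auto
    have "h (UUV_gen n k (Rho i)) = ?t i"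
      using hg[OF UV_gen_in_carrier[OF i]] gg[OF i] by (simp add: UUV_gen_def)
    then show ?thesis using imageI[OF UUV_gen_in_carrier[OF i], of h] by simp
  qed
  have image: "subgroup (h ` carrier (UUV n k)) ?S" by (rule h.img_is_subgroup)
  have "p \<in> h ` carrier (UUV n k)" if "p permutes {1..n}" for p
    using that
  proof (rule permutes_adjacent_induct)
    show "id \<in> h ` carrier (UUV n k)" using subgroup.one_closed[OF image] by (simp add: sym_group_one)
  next
    fix i q assume "1 \<le> i" "i < n" "q \<in> h ` carrier (UUV n k)"
    then show "?t i \<circ> q \<in> h ` carrier (UUV n k)"
      using subgroup.m_closed[OF image ht] by (simp add: sym_group_mult)
  qed
  then have "h ` carrier (UUV n k) = carrier ?S"
    using h.hom_closed by (auto simp: sym_group_carrier)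
  then show ?thesis using that h.group_hom_axioms by blast
qed

lemma sym_group_not_comm:
  assumes "n \<ge> 3"
  shows "\<not> comm_group (sym_group n)"
proof
  assume "comm_group (sym_group n)"
  then interpret comm_group "sym_group n" .
  have "transpose 1 2 \<in> carrier (sym_group n)" "transpose 2 3 \<in> carrier (sym_group n)"
    using assms by (auto simp: sym_group_carrier intro!: permutes_swap_id)
  then have "transpose 1 2 \<circ> transpose 2 (3::nat) = transpose 2 3 \<circ> transpose 1 2"
    using m_comm by (simp add: sym_group_mult)
  then have "(transpose 1 2 \<circ> transpose 2 (3::nat)) 1 = (transpose 2 3 \<circ> transpose 1 2) 1" by simp
  then show False by (simp add: transpose_def)
qed

theorem proposition4p7:
  fixes n k :: nat
  assumes "n \<ge> 5" and "k \<ge> 1"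
  shows "perfect (commutator_subgroup (UUV n k))
       \<and> smallest_nonabelian_finite_quotient (sym_group n) (UUV n k)"
proof
  interpret U: uv_group "UUV n k" n k "\<lambda>i. UUV_gen n k (Rho i)" "\<lambda>i t. UUV_gen n k (Sig i t)"
    by (rule uv_group_UUV)
  show "perfect (commutator_subgroup (UUV n k))"
    using U.derived_eq_second_derived assms(1) by (simp add: U.perfect_commutator_subgroup_iff)
  obtain h where hom: "group_hom (UUV n k) (sym_group n) h"
    and onto: "h ` carrier (UUV n k) = carrier (sym_group n)"
    using UUV_onto_sym_group .
  have "\<exists>N. N \<lhd> UUV n k \<and> UUV n k Mod N \<cong> sym_group n"
    using group_hom.FactGroup_iso[OF hom onto] group_hom.normal_kernel[OF hom] by blast
  moreover have order: "order (sym_group n) = fact n"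
    by (simp add: order_def sym_group_card_carrier)
  have "finite (carrier (sym_group n))"
    by (simp add: sym_group_def finite_permutations)
  moreover have "order (sym_group n) \<le> order (UUV n k Mod N)"
    if "N \<lhd> UUV n k" "finite (carrier (UUV n k Mod N))" "\<not> comm_group (UUV n k Mod N)" for N
    using uv_group.fact_le_order_of_nonabelian[OF U.uv_group_Mod[OF that(1)] assms(1) that(2,3)]
      order by simp
  ultimately show "smallest_nonabelian_finite_quotient (sym_group n) (UUV n k)"
    using sym_group_is_group sym_group_not_comm[of n] assms(1)
    by (simp add: smallest_nonabelian_finite_quotient_def)
qed

end
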